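(* Let $p_1,\ldots,p_r\in\mathbb{R}[X_1,\ldots,X_n]$, let $S=\{x\in\mathbb{R}^n\mid p_1(x)\ge 0,\ldots,p_r(x)\ge 0\}$, and let $L$ be a line in $\mathbb{R}^n$ such that $S\cap L$ has non-empty interior relative to $L$. Let $a\in S$ be a point that belongs to the relative boundary of $\overline{\operatorname{conv}(S)}\cap L$ in $L$. Assume that for all $p_i$ with $p_i(a)=0$ the gradient vector $\nabla p_i(a)$ is orthogonal to $L$. Then, for all $d$, the Lasserre relaxation $\mathscr{L}(\underline p)_d$ strictly contains $\overline{\operatorname{conv}(S)}$.
   Context: Write $\underline X=(X_1,\ldots,X_n)$, and let $\mathbb{R}[\underline X]_d$ be the space of real polynomials of degree at most $d$. For $\underline p=(p_1,\ldots,p_r)$ define the truncated quadratic module $\mathrm{QM}(\underline p)_d=\{\sigma_0+\sigma_1p_1+\cdots+\sigma_rp_r\mid \sigma_i\in\sum(\mathbb{R}[\underline X]_d)^2\}$, where $\sum(\mathbb{R}[\underline X]_d)^2$ is the set of finite sums of squares of elements of $\mathbb{R}[\underline X]_d$. The degree $d$ Lasserre relaxation is $\mathscr{L}(\underline p)_d=\{x\in\mathbb{R}^n\mid \ell(x)\ge 0 \text{ for all } \ell\in \mathrm{QM}(\underline p)_d\cap\mathbb{R}[\underline X]_1\}$. Orthogonal to $L$ means orthogonal to the direction vector of $L$. *)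

theory Defs
  imports "HOL-Analysis.Analysis" "HOL-Library.Poly_Mapping"
begin

text \<open>
  The ring \<open>\<real>[X\<^sub>1,\<dots>,X\<^sub>n]\<close>: the variables are indexed by the finite type \<open>'n\<close>, so \<open>n = CARD('n)\<close>.
  A monomial is its exponent vector of type \<open>'n \<Rightarrow>\<^sub>0 nat\<close>, a polynomial is the finitely supported
  family of its coefficients, and the multiplication of \<open>Poly_Mapping\<close> is the convolution product.
\<close>

type_synonym 'n rpoly = "('n \<Rightarrow>\<^sub>0 nat) \<Rightarrow>\<^sub>0 real"

definition poly_eval :: "'n::finite rpoly \<Rightarrow> real ^ 'n \<Rightarrow> real" where
  "poly_eval p x =
     (\<Sum>m\<in>Poly_Mapping.keys p. Poly_Mapping.lookup p m * (\<Prod>k\<in>UNIV. x $ k ^ Poly_Mapping.lookup m k))"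

definition polys_upto :: "nat \<Rightarrow> 'n::finite rpoly set" where
  "polys_upto d = {p. \<forall>m\<in>Poly_Mapping.keys p. (\<Sum>k\<in>UNIV. Poly_Mapping.lookup m k) \<le> d}"

definition poly_gradient :: "'n::finite rpoly \<Rightarrow> real ^ 'n \<Rightarrow> real ^ 'n" where
  "poly_gradient p x = (\<chi> k. deriv (\<lambda>t. poly_eval p (x + t *\<^sub>R axis k 1)) 0)"

definition sums_of_squares :: "nat \<Rightarrow> 'n::finite rpoly set" where
  "sums_of_squares d = {(\<Sum>j<N. (q j)\<^sup>2) | (N :: nat) q. \<forall>j<N. q j \<in> polys_upto d}"

text \<open>
  A tuple \<open>(p\<^sub>1,\<dots>,p\<^sub>r)\<close> is given by a sequence \<open>p\<close> and its length \<open>r\<close>; only the values of \<open>p\<close>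
  at \<open>1,\<dots>,r\<close> matter.  The degree bound \<open>d\<close> concerns the polynomials that are squared,
  so \<open>QM p r d\<close> also contains polynomials of degree greater than \<open>d\<close>.
\<close>

definition QM :: "(nat \<Rightarrow> 'n::finite rpoly) \<Rightarrow> nat \<Rightarrow> nat \<Rightarrow> 'n rpoly set" where
  "QM p r d = {\<sigma> 0 + (\<Sum>i=1..r. \<sigma> i * p i) | \<sigma> :: nat \<Rightarrow> 'n rpoly. \<forall>i\<le>r. \<sigma> i \<in> sums_of_squares d}"

definition lasserre :: "(nat \<Rightarrow> 'n::finite rpoly) \<Rightarrow> nat \<Rightarrow> nat \<Rightarrow> (real ^ 'n) set" where
  "lasserre p r d = {x. \<forall>l \<in> QM p r d \<inter> polys_upto 1. poly_eval l x \<ge> 0}"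

definition basic_closed :: "(nat \<Rightarrow> 'n::finite rpoly) \<Rightarrow> nat \<Rightarrow> (real ^ 'n) set" where
  "basic_closed p r = {x. \<forall>i\<in>{1..r}. poly_eval (p i) x \<ge> 0}"

lemma poly_eval_differentiable: "poly_eval p differentiable (at x)"
  unfolding poly_eval_def[abs_def] differentiable_def
  by (rule exI, (rule derivative_eq_intros | rule bounded_linear_imp_has_derivative bounded_linear_vec_nth refl)+)

text \<open>The vector of partial derivatives is the gradient in the sense of \<^const>\<open>gderiv\<close>.\<close>

lemma poly_gradient_gderiv: "GDERIV (poly_eval p) x :> poly_gradient p x"
proof -
  obtain D where D: "(poly_eval p has_derivative D) (at x)"
    using poly_eval_differentiable unfolding differentiable_def by blast
  then interpret D: bounded_linear D by (rule has_derivative_bounded_linear)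
  have partial: "poly_gradient p x $ k = D (axis k 1)" for k
  proof -
    have 1: "((\<lambda>t. x + t *\<^sub>R axis k 1) has_derivative (\<lambda>t. t *\<^sub>R axis k 1)) (at (0::real))"
      by (auto intro!: derivative_eq_intros)
    have "((\<lambda>t. poly_eval p (x + t *\<^sub>R axis k 1)) has_derivative (\<lambda>t. D (t *\<^sub>R axis k 1))) (at 0)"
      using has_derivative_compose[OF 1, of "poly_eval p" D] D by simp
    then have "((\<lambda>t. poly_eval p (x + t *\<^sub>R axis k 1)) has_field_derivative D (axis k 1)) (at 0)"
      by (rule has_derivative_imp_has_field_derivative) (simp add: D.scaleR)
    then show ?thesis by (simp add: poly_gradient_def DERIV_imp_deriv)
  qed
  have "D h = h \<bullet> poly_gradient p x" for h
  proof -
    have "D h = D (\<Sum>k\<in>UNIV. h $ k *\<^sub>R axis k 1)"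
      by (simp add: basis_expansion scalar_mult_eq_scaleR[symmetric])
    then show ?thesis by (simp add: D.sum D.scaleR inner_vec_def partial)
  qed
  then have "D = (\<lambda>h. h \<bullet> poly_gradient p x)" by blast
  with D show ?thesis by (simp add: gderiv_def)
qed

end

theory Submission
  imports Defs
begin

text \<open>
  If the relaxation coincided with the closed convex hull, then every point of \<open>L\<close> beyond \<open>a\<close>
  would be cut off by an affine element of the truncated quadratic module.  Restrict these elements
  to \<open>L\<close>, with parameter \<open>t\<close> such that \<open>a\<close> is \<open>t = 0\<close>, and normalise: for arbitrarily small
  \<open>\<alpha> \<ge> 0\<close> there is a representation \<open>t + \<alpha> = \<Sum>\<^sub>i \<sigma>\<^sub>i(t) q\<^sub>i(t)\<close>.  Since \<open>S \<inter> L\<close> is infinite,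
  Lagrange interpolation at nodes where the non-zero \<open>q\<^sub>i\<close> are positive bounds the \<open>\<sigma>\<^sub>i\<close>
  on \<open>[-1,0]\<close> independently of \<open>\<alpha>\<close>.  The gradient condition gives \<open>q\<^sub>i(-h) \<ge> - C h\<^sup>2\<close> for small
  \<open>h > 0\<close>, so \<open>\<alpha> - h \<ge> - C' h\<^sup>2\<close>, which is impossible once \<open>h\<close> and then \<open>\<alpha>\<close> are small.
\<close>

section \<open>Evaluation of polynomials and restriction to lines\<close>

lemma poly_eval_superset:
  assumes "finite A" "Poly_Mapping.keys p \<subseteq> A"
  shows "poly_eval p x =
    (\<Sum>m\<in>A. Poly_Mapping.lookup p m * (\<Prod>k\<in>UNIV. x $ k ^ Poly_Mapping.lookup m k))"
  unfolding poly_eval_def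
  by (rule sum.mono_neutral_left) (use assms in \<open>auto simp: in_keys_iff\<close>)

lemma poly_eval_zero [simp]: "poly_eval 0 x = 0"
  by (simp add: poly_eval_def)

lemma poly_eval_add: "poly_eval (p + q) x = poly_eval p x + poly_eval q x"
proof -
  let ?A = "Poly_Mapping.keys p \<union> Poly_Mapping.keys q"
  have "Poly_Mapping.keys (p + q) \<subseteq> ?A"
    by (rule keys_add)
  then show ?thesis
    by (simp add: poly_eval_superset[of ?A] lookup_add distrib_right sum.distrib)
qed

lemma poly_eval_sum: "poly_eval (\<Sum>i\<in>I. f i) x = (\<Sum>i\<in>I. poly_eval (f i) x)"
  by (induction I rule: infinite_finite_induct) (simp_all add: poly_eval_add)

lemma poly_eval_single:
  "poly_eval (Poly_Mapping.single m c) x = c * (\<Prod>k\<in>UNIV. x $ k ^ Poly_Mapping.lookup m k)"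
  by (simp add: poly_eval_superset[of "{m}"])

lemma poly_mapping_sum_singles:
  "(\<Sum>m\<in>Poly_Mapping.keys p. Poly_Mapping.single m (Poly_Mapping.lookup p m)) = p"
  by (rule poly_mapping_eqI)
    (auto simp: lookup_sum lookup_single when_def in_keys_iff sum.delta')

text \<open>Expanding both factors into monomials reduces the convolution product to
  \<open>mult_single\<close>, that is, to adding exponents.\<close>

lemma poly_eval_mult: "poly_eval (p * q) x = poly_eval p x * poly_eval q x"
proof -
  let ?s = "\<lambda>p :: 'a rpoly. \<lambda>m. Poly_Mapping.single m (Poly_Mapping.lookup p m)"
  have "p * q = (\<Sum>m\<in>Poly_Mapping.keys p. \<Sum>n\<in>Poly_Mapping.keys q. ?s p m * ?s q n)"
    by (simp only: sum_product[symmetric] poly_mapping_sum_singles)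
  then show ?thesis
    by (simp add: poly_eval_sum mult_single poly_eval_single lookup_add power_add prod.distrib
        poly_eval_def[of p] poly_eval_def[of q] sum_product algebra_simps)
qed

lemma poly_eval_power2: "poly_eval (p\<^sup>2) x = (poly_eval p x)\<^sup>2"
  by (simp add: power2_eq_square poly_eval_mult)

text \<open>The substitution is carried out formally, so that degree, roots and
  \<open>pderiv\<close> of the restriction to the line are available.\<close>

definition line_poly :: "real ^ 'n \<Rightarrow> real ^ 'n \<Rightarrow> 'n::finite rpoly \<Rightarrow> real poly" where
  "line_poly a v p = (\<Sum>m\<in>Poly_Mapping.keys p.
     smult (Poly_Mapping.lookup p m) (\<Prod>k\<in>UNIV. [:a $ k, v $ k:] ^ Poly_Mapping.lookup m k))"

lemma poly_line_poly [simp]: "poly (line_poly a v p) t = poly_eval p (a + t *\<^sub>R v)"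
  by (simp add: line_poly_def poly_eval_def poly_sum poly_prod)

lemma degree_line_poly:
  assumes "p \<in> polys_upto d"
  shows "degree (line_poly a v p) \<le> d"
  unfolding line_poly_def
proof (rule degree_sum_le)
  fix m assume m: "m \<in> Poly_Mapping.keys p"
  have "degree ([:a $ k, v $ k:] ^ Poly_Mapping.lookup m k) \<le> Poly_Mapping.lookup m k" for k
    by (rule order_trans[OF degree_power_le]) auto
  then have "degree (\<Prod>k\<in>UNIV. [:a $ k, v $ k:] ^ Poly_Mapping.lookup m k)
      \<le> (\<Sum>k\<in>UNIV. Poly_Mapping.lookup m k)"
    by (intro order_trans[OF degree_prod_sum_le] sum_mono) auto
  also have "\<dots> \<le> d"
    using assms m by (auto simp: polys_upto_def)
  finally show "degree (smult (Poly_Mapping.lookup p m)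
      (\<Prod>k\<in>UNIV. [:a $ k, v $ k:] ^ Poly_Mapping.lookup m k)) \<le> d"
    using degree_smult_le order_trans by blast
qed simp

text \<open>Chain rule at 0: orthogonality of the gradient to the line becomes vanishing of the
  linear coefficient of the restriction.\<close>

lemma poly_pderiv_line_poly:
  "poly (pderiv (line_poly a v p)) 0 = v \<bullet> poly_gradient p a"
proof -
  have "((\<lambda>t. poly_eval p (a + t *\<^sub>R v)) has_derivative (\<lambda>t. (t *\<^sub>R v) \<bullet> poly_gradient p a)) (at 0)"
    by (rule has_derivative_compose[of "\<lambda>t. a + t *\<^sub>R v" "\<lambda>t. t *\<^sub>R v"])
      (use poly_gradient_gderiv[of p a] in \<open>auto simp: gderiv_def intro!: derivative_eq_intros\<close>)
  then have "DERIV (poly (line_poly a v p)) 0 :> v \<bullet> poly_gradient p a"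
    by (simp add: has_field_derivative_def mult.commute[of _ "v \<bullet> poly_gradient p a"]
        flip: poly_line_poly)
  then show ?thesis
    using DERIV_unique poly_DERIV by blast
qed

lemma poly_eval_affine_on_line:
  assumes "l \<in> polys_upto 1"
  obtains A B where "\<And>t. poly_eval l (a + t *\<^sub>R v) = A + t * B"
proof -
  obtain A q where q: "line_poly a v l = pCons A q"
    by (cases "line_poly a v l")
  then have "degree q = 0"
    using degree_line_poly[OF assms, of a v] by (auto split: if_splits)
  then obtain B where "q = [:B:]"
    by (rule degree_eq_zeroE)
  then have "poly_eval l (a + t *\<^sub>R v) = A + t * B" for t
    using poly_line_poly[of a v l t] q by simp
  then show ?thesis by (rule that)
qed

text \<open>The degree doubles because \<open>d\<close> bounds the polynomials before squaring.
  Unlike the restricted constraints, \<open>f\<close> is nonnegative on the whole line.\<close>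

lemma sums_of_squares_on_line:
  assumes "s \<in> sums_of_squares d"
  obtains f where "degree f \<le> 2 * d" "\<And>t. 0 \<le> poly f t"
    "\<And>t. poly f t = poly_eval s (a + t *\<^sub>R v)"
proof -
  obtain N :: nat and q where s: "s = (\<Sum>j<N. (q j)\<^sup>2)" and q: "\<forall>j<N. q j \<in> polys_upto d"
    using assms by (auto simp: sums_of_squares_def)
  define f where "f = (\<Sum>j<N. (line_poly a v (q j))\<^sup>2)"
  have "degree f \<le> 2 * d"
    unfolding f_def
  proof (rule degree_sum_le)
    fix j assume "j \<in> {..<N}"
    then have "degree (line_poly a v (q j)) * 2 \<le> 2 * d"
      using q degree_line_poly by fastforce
    then show "degree ((line_poly a v (q j))\<^sup>2) \<le> 2 * d"
      using degree_power_le order_trans by blast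
  qed simp
  then show ?thesis
    by (rule that) (simp_all add: f_def s poly_sum poly_eval_sum poly_eval_power2 sum_nonneg)
qed

section \<open>Univariate estimates\<close>

text \<open>Both sides have degree below \<open>card X\<close> and agree at every node, since each
  basis product is 1 at its own node and 0 at the others.\<close>

lemma Lagrange_interpolation:
  fixes f :: "'a::field poly"
  assumes "finite X" "degree f < card X"
  shows "f = (\<Sum>x\<in>X. smult (poly f x) (\<Prod>y\<in>X-{x}. smult (inverse (x - y)) [:- y, 1:]))"
    (is "f = ?g")
proof (rule poly_eqI_degree[of X])
  fix z assume z: "z \<in> X"
  have "poly ?g z = (\<Sum>x\<in>X. if x = z then poly f x else 0)"
    unfolding poly_sum
  proof (rule sum.cong)
    fix x assume "x \<in> X"
    have "(\<Prod>y\<in>X-{x}. (z - y) / (x - y)) = (if x = z then 1 else 0)"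
    proof (cases "x = z")
      case True
      then show ?thesis by (intro trans[OF prod.neutral]) auto
    next
      case False
      then show ?thesis using z assms(1) by (auto simp: prod_zero_iff)
    qed
    then show "poly (smult (poly f x) (\<Prod>y\<in>X-{x}. smult (inverse (x - y)) [:- y, 1:])) z =
        (if x = z then poly f x else 0)"
      by (simp add: poly_prod divide_inverse mult.commute flip: left_diff_distrib)
  qed simp
  then show "poly f z = poly ?g z"
    using z assms(1) by simp
next
  have "degree ?g \<le> card X - 1"
  proof (rule degree_sum_le)
    fix x assume x: "x \<in> X"
    have "degree (\<Prod>y\<in>X-{x}. smult (inverse (x - y)) [:- y, 1:]) \<le> (\<Sum>y\<in>X-{x}. 1)"
      by (intro order_trans[OF degree_prod_sum_le] sum_mono) (use assms in auto)
    then show "degree (smult (poly f x) (\<Prod>y\<in>X-{x}. smult (inverse (x - y)) [:- y, 1:]))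
        \<le> card X - 1"
      using x assms(1) degree_smult_le order_trans by fastforce
  qed fact
  then show "card X > degree ?g"
    using assms(2) by linarith
qed (use assms in auto)

lemma poly_bounded_on_interval:
  fixes f :: "real poly"
  obtains M where "M \<ge> 0" "\<And>t. t \<in> {a..b} \<Longrightarrow> \<bar>poly f t\<bar> \<le> M"
proof -
  have "compact (poly f ` {a..b})"
    by (intro compact_continuous_image continuous_intros) simp
  then have "bounded (poly f ` {a..b})"
    by (rule compact_imp_bounded)
  then obtain M where "M > 0" "\<forall>y\<in>poly f ` {a..b}. norm y \<le> M"
    using bounded_pos by blast
  then show ?thesis
    by (intro that[of M]) auto
qed

text \<open>The Lagrange basis depends on \<open>X\<close> alone and is bounded on the compact
  interval. Hence \<open>M\<close> can be fixed before \<open>f\<close>.\<close>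

lemma poly_bounded_by_node_values:
  fixes Y :: "real \<Rightarrow> real"
  assumes "finite X"
  obtains M where "M \<ge> 0"
    "\<And>f t. \<lbrakk>degree f < card X; \<And>x. x \<in> X \<Longrightarrow> \<bar>poly f x\<bar> \<le> Y x; t \<in> {a..b}\<rbrakk> \<Longrightarrow> \<bar>poly f t\<bar> \<le> M"
proof -
  define w where "w x = (\<Prod>y\<in>X-{x}. smult (inverse (x - y)) [:- y, 1:])" for x
  have "\<exists>W. \<forall>t\<in>{a..b}. \<bar>poly (w x) t\<bar> \<le> W \<and> W \<ge> 0" for x
    using poly_bounded_on_interval by metis
  then obtain W where W: "\<And>x t. t \<in> {a..b} \<Longrightarrow> \<bar>poly (w x) t\<bar> \<le> W x \<and> W x \<ge> 0"
    by metis
  \<comment> \<open>A negative \<open>Y x\<close> at a node excludes every \<open>f\<close>; the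
    absolute value secures \<open>M \<ge> 0\<close> even then.\<close>
  define M where "M = \<bar>\<Sum>x\<in>X. Y x * W x\<bar>"
  have "\<bar>poly f t\<bar> \<le> M"
    if f: "degree f < card X" and Y: "\<And>x. x \<in> X \<Longrightarrow> \<bar>poly f x\<bar> \<le> Y x" and t: "t \<in> {a..b}" for f t
  proof -
    have "poly f t = poly (\<Sum>x\<in>X. smult (poly f x) (w x)) t"
      using Lagrange_interpolation[OF assms f] by (simp add: w_def)
    then have "\<bar>poly f t\<bar> \<le> (\<Sum>x\<in>X. \<bar>poly f x * poly (w x) t\<bar>)"
      by (simp add: poly_sum)
    also have "\<dots> \<le> (\<Sum>x\<in>X. Y x * W x)"
      unfolding abs_mult
    proof (intro sum_mono mult_mono)
      fix x assume "x \<in> X"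
      then show "\<bar>poly f x\<bar> \<le> Y x" "0 \<le> Y x"
        using Y[of x] by auto
    qed (use W t in auto)
    finally show ?thesis
      by (simp add: M_def)
  qed
  moreover have "M \<ge> 0"
    by (simp add: M_def)
  ultimately show ?thesis
    using that by blast
qed

text \<open>A positive value at 0 persists nearby, so \<open>C = 0\<close> works. Otherwise 0 is a
  double root, \<open>q\<close> is \<open>t\<^sup>2\<close> times a polynomial \<open>g\<close>, and
  a bound for \<open>g\<close> on \<open>[-1,0]\<close> serves as \<open>C\<close>.\<close>

lemma poly_quadratic_lower_bound:
  fixes q :: "real poly"
  assumes "poly q 0 > 0 \<or> poly q 0 = 0 \<and> poly (pderiv q) 0 = 0"
  shows "\<exists>C. C \<ge> 0 \<and> (\<forall>\<^sub>F h in at_right 0. poly q (- h) \<ge> - C * h\<^sup>2)"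
  using assms
proof (elim disjE conjE)
  assume "poly q 0 > 0"
  moreover have "((\<lambda>h. poly q (- h)) \<longlongrightarrow> poly q (- 0)) (at_right 0)"
    by (intro tendsto_intros)
  ultimately have "\<forall>\<^sub>F h in at_right 0. poly q (- h) > 0"
    by (simp add: order_tendstoD)
  then show ?thesis
    by (intro exI[of _ 0]) (auto elim: eventually_mono)
next
  assume 0: "poly q 0 = 0" "poly (pderiv q) 0 = 0"
  obtain c q1 where q: "q = pCons c q1" by (cases q)
  obtain c1 g where q1: "q1 = pCons c1 g" by (cases q1)
  have "c = 0" "c1 = 0"
    using 0 by (simp_all add: q q1 pderiv_pCons)
  then have q: "poly q t = t\<^sup>2 * poly g t" for t
    by (simp add: q q1 power2_eq_square)
  obtain M where M: "M \<ge> 0" "\<And>t. t \<in> {-1..0} \<Longrightarrow> \<bar>poly g t\<bar> \<le> M"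
    using poly_bounded_on_interval[of "-1" 0 g] by metis
  have "poly q (- h) \<ge> - M * h\<^sup>2" if "h \<in> {0<..<1}" for h
  proof -
    have "poly g (- h) \<ge> - M"
      using M(2)[of "- h"] that by auto
    then have "h\<^sup>2 * poly g (- h) \<ge> h\<^sup>2 * - M"
      by (rule mult_left_mono) simp
    then show ?thesis
      by (simp add: q mult.commute)
  qed
  moreover have "\<forall>\<^sub>F h in at_right (0::real). h \<in> {0<..<1}"
    by (rule eventually_at_right_real) simp
  ultimately show ?thesis
    using M(1) by (intro exI[of _ M]) (auto elim: eventually_mono)
qed

text \<open>The crucial point is uniformity: \<open>\<epsilon>\<close> is chosen before
  \<open>\<alpha>\<close> and \<open>\<sigma>\<close>. At \<open>- h\<close> the sum equals
  \<open>\<alpha> - h\<close>, while every summand is at least a constant times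
  \<open>- h\<^sup>2\<close>, with a constant independent of \<open>\<alpha>\<close> and
  \<open>\<sigma>\<close>.\<close>

lemma weighted_sum_offset_bounded_below:
  fixes q :: "'i \<Rightarrow> real poly" and J :: "real set"
  assumes I: "finite I" and J: "infinite J"
    and nonneg: "\<And>i t. i \<in> I \<Longrightarrow> t \<in> J \<Longrightarrow> poly (q i) t \<ge> 0"
    and at0: "\<And>i. i \<in> I \<Longrightarrow> poly (q i) 0 > 0 \<or> poly (q i) 0 = 0 \<and> poly (pderiv (q i)) 0 = 0"
  shows "\<exists>\<epsilon>>0. \<forall>\<alpha> \<sigma>. (\<forall>i\<in>I. degree (\<sigma> i) \<le> D \<and> (\<forall>t. poly (\<sigma> i) t \<ge> 0)) \<longrightarrow>
    (\<forall>t. (\<Sum>i\<in>I. poly (\<sigma> i) t * poly (q i) t) = t + \<alpha>) \<longrightarrow> \<epsilon> \<le> \<alpha>"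
proof -
  \<comment> \<open>Off \<open>Z\<close>, every non-zero \<open>q i\<close> is strictly positive on
    \<open>J\<close>. A zero \<open>q i\<close> has to be left out, as all points would be roots;
    its summand vanishes anyway.\<close>
  define Z where "Z = (\<Union>i\<in>{i\<in>I. q i \<noteq> 0}. {t. poly (q i) t = 0})"
  have "finite Z"
    unfolding Z_def using I poly_roots_finite by auto
  then have "infinite (J - Z)"
    using J by simp
  \<comment> \<open>\<open>Suc D\<close> nodes determine a polynomial of degree at most
    \<open>D\<close>.\<close>
  then obtain X where X: "finite X" "card X = Suc D" "X \<subseteq> J - Z"
    using infinite_arbitrarily_large by blast
  define adm where "adm \<alpha> \<sigma> \<longleftrightarrow> (\<forall>i\<in>I. degree (\<sigma> i) \<le> D \<and> (\<forall>t. poly (\<sigma> i) t \<ge> 0)) \<and>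
    (\<forall>t. (\<Sum>i\<in>I. poly (\<sigma> i) t * poly (q i) t) = t + \<alpha>)" for \<alpha> :: real and \<sigma> :: "'i \<Rightarrow> real poly"
  \<comment> \<open>\<open>K\<close> and \<open>h\<close> are fixed before \<open>\<alpha>\<close>
    and \<open>\<sigma>\<close>. The restriction \<open>\<alpha> \<le> 1\<close> makes the node
    values bounded; larger offsets are trivial at the end.\<close>
  define below where "below i K h \<longleftrightarrow> (\<forall>\<alpha> \<sigma>. adm \<alpha> \<sigma> \<longrightarrow> \<alpha> \<le> 1 \<longrightarrow>
      poly (\<sigma> i) (- h) * poly (q i) (- h) \<ge> - K * h\<^sup>2)" for i K h
  have ex_below: "\<exists>K. \<forall>\<^sub>F h in at_right 0. below i K h" if i: "i \<in> I" for i
  proof (cases "q i = 0")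
    case True
    then show ?thesis
      by (intro exI[of _ 0]) (simp add: below_def)
  next
    case False
    obtain M where M: "M \<ge> 0"
      "\<And>f t. \<lbrakk>degree f < card X; \<And>x. x \<in> X \<Longrightarrow> \<bar>poly f x\<bar> \<le> (x + 1) / poly (q i) x; t \<in> {-1..0}\<rbrakk>
        \<Longrightarrow> \<bar>poly f t\<bar> \<le> M"
      using poly_bounded_by_node_values[OF X(1), of "\<lambda>x. (x + 1) / poly (q i) x" "-1" 0] by blast
    have bound: "poly (\<sigma> i) t \<le> M" if adm: "adm \<alpha> \<sigma>" and "\<alpha> \<le> 1" and t: "t \<in> {-1..0}" for \<alpha> \<sigma> t
    proof -
      have "\<bar>poly (\<sigma> i) x\<bar> \<le> (x + 1) / poly (q i) x" if x: "x \<in> X" for x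
      proof -
        have "poly (q i) x \<ge> 0" "poly (q i) x \<noteq> 0"
          using nonneg[of i x] x X(3) i False by (auto simp: Z_def)
        then have pos: "poly (q i) x > 0" by simp
        \<comment> \<open>At a node all summands are nonnegative, so a single one is at most the
          whole sum \<open>x + \<alpha>\<close>.\<close>
        have "poly (\<sigma> i) x * poly (q i) x \<le> (\<Sum>j\<in>I. poly (\<sigma> j) x * poly (q j) x)"
          using adm x X(3) i I
          by (intro member_le_sum) (auto simp: adm_def intro!: nonneg mult_nonneg_nonneg)
        also have "\<dots> \<le> x + 1"
          using adm \<open>\<alpha> \<le> 1\<close> by (simp add: adm_def)
        finally show ?thesis
          using pos adm i by (simp add: field_simps adm_def)
      qed
      moreover have "degree (\<sigma> i) < card X"
        using adm i X(2) by (auto simp: adm_def)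
      ultimately have "\<bar>poly (\<sigma> i) t\<bar> \<le> M"
        using t by (intro M(2))
      then show ?thesis by simp
    qed
    obtain C where C: "C \<ge> 0" "\<forall>\<^sub>F h in at_right 0. poly (q i) (- h) \<ge> - C * h\<^sup>2"
      using poly_quadratic_lower_bound[OF at0[OF i]] by blast
    have "\<forall>\<^sub>F h in at_right (0::real). h \<in> {0<..<1}"
      by (rule eventually_at_right_real) simp
    with C(2) have "\<forall>\<^sub>F h in at_right 0. below i (M * C) h"
    proof eventually_elim
      case (elim h)
      show ?case
        unfolding below_def
      proof (intro allI impI)
        fix \<alpha> \<sigma> assume adm: "adm \<alpha> \<sigma>" "\<alpha> \<le> 1"
        have s: "0 \<le> poly (\<sigma> i) (- h)" "poly (\<sigma> i) (- h) \<le> M"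
          using adm i bound[OF adm, of "- h"] elim(2) by (auto simp: adm_def)
        have "poly (\<sigma> i) (- h) * (C * h\<^sup>2) \<le> M * (C * h\<^sup>2)"
          using s C(1) by (intro mult_right_mono) auto
        moreover have "poly (\<sigma> i) (- h) * (- C * h\<^sup>2) \<le> poly (\<sigma> i) (- h) * poly (q i) (- h)"
          using s elim(1) by (intro mult_left_mono) auto
        ultimately show "- (M * C) * h\<^sup>2 \<le> poly (\<sigma> i) (- h) * poly (q i) (- h)"
          by (simp add: algebra_simps)
      qed
    qed
    then show ?thesis by blast
  qed
  obtain K where K: "\<forall>i\<in>I. \<forall>\<^sub>F h in at_right 0. below i (K i) h"
    using bchoice[of I "\<lambda>i K. \<forall>\<^sub>F h in at_right 0. below i K h"] ex_below by blast
  \<comment> \<open>The absolute value makes \<open>C + 1\<close> positive whatever the signs of the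
    \<open>K i\<close>.\<close>
  define C where "C = \<bar>\<Sum>i\<in>I. K i\<bar>"
  have "\<forall>\<^sub>F h in at_right 0. \<forall>i\<in>I. below i (K i) h"
    using I K by (rule eventually_ball_finite)
  \<comment> \<open>For such \<open>h\<close> the loss \<open>C * h\<^sup>2\<close> is at most
    \<open>h / 2\<close>, so \<open>\<alpha> - h \<ge> - C * h\<^sup>2\<close> leaves
    \<open>\<alpha> \<ge> h / 2\<close>.\<close>
  moreover have "\<forall>\<^sub>F h in at_right 0. h \<in> {0<..<1 / (2 * (C + 1))}"
    by (rule eventually_at_right_real) (simp add: C_def)
  ultimately have "\<forall>\<^sub>F h in at_right 0. h \<in> {0<..<1 / (2 * (C + 1))} \<and> (\<forall>i\<in>I. below i (K i) h)"
    by eventually_elim blast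
  then obtain h where "h \<in> {0<..<1 / (2 * (C + 1))}" and below: "\<forall>i\<in>I. below i (K i) h"
    using eventually_happens'[OF trivial_limit_at_right_real] by blast
  then have h: "0 < h" "h < 1 / (2 * (C + 1))"
    by auto
  have "C * h \<le> 1 / 2"
  proof -
    have "h * (2 * (C + 1)) < 1"
      using h by (simp add: C_def pos_less_divide_eq)
    then show ?thesis
      using h(1) by (simp add: algebra_simps)
  qed
  then have Ch: "C * h\<^sup>2 \<le> h / 2"
    using mult_right_mono[of "C * h" "1 / 2" h] h(1) by (simp add: power2_eq_square mult.assoc)
  have "min 1 (h / 2) \<le> \<alpha>" if adm: "adm \<alpha> \<sigma>" for \<alpha> \<sigma>
  proof (cases "\<alpha> \<le> 1")
    case True
    have "- C * h\<^sup>2 \<le> - (\<Sum>i\<in>I. K i) * h\<^sup>2"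
      by (intro mult_right_mono) (simp_all add: C_def)
    also have "\<dots> = (\<Sum>i\<in>I. - K i * h\<^sup>2)"
      by (simp add: sum_distrib_right sum_negf)
    also have "\<dots> \<le> (\<Sum>i\<in>I. poly (\<sigma> i) (- h) * poly (q i) (- h))"
      using below adm True by (intro sum_mono) (simp add: below_def)
    also have "\<dots> = - h + \<alpha>"
      using adm by (simp add: adm_def)
    finally show ?thesis
      using Ch by auto
  qed auto
  then show ?thesis
    using h(1) unfolding adm_def by (intro exI[of _ "min 1 (h / 2)"]) simp
qed

section \<open>The relaxation and the closed convex hull\<close>

lemma poly_eval_nonneg_if_sums_of_squares: "s \<in> sums_of_squares d \<Longrightarrow> poly_eval s x \<ge> 0"
  by (auto simp: sums_of_squares_def poly_eval_sum poly_eval_power2 intro!: sum_nonneg)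

lemma poly_eval_QM_nonneg:
  assumes "l \<in> QM p r d" "x \<in> basic_closed p r"
  shows "poly_eval l x \<ge> 0"
proof -
  obtain \<sigma> where \<sigma>: "l = \<sigma> 0 + (\<Sum>i=1..r. \<sigma> i * p i)" "\<forall>i\<le>r. \<sigma> i \<in> sums_of_squares d"
    using assms(1) by (auto simp: QM_def)
  have "poly_eval (\<sigma> i) x \<ge> 0" if "i \<le> r" for i
    using \<sigma>(2) that poly_eval_nonneg_if_sums_of_squares by blast
  then show ?thesis
    using assms(2)
    by (auto simp: \<sigma>(1) poly_eval_add poly_eval_sum poly_eval_mult basic_closed_def
        intro!: add_nonneg_nonneg sum_nonneg mult_nonneg_nonneg)
qed

lemma convex_poly_eval_nonneg:
  assumes "l \<in> polys_upto 1"
  shows "convex {x. poly_eval l x \<ge> 0}"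
  unfolding convex_alt
proof (clarsimp)
  fix x y :: "real ^ 'a" and u :: real
  assume xy: "0 \<le> poly_eval l x" "0 \<le> poly_eval l y" and u: "0 \<le> u" "u \<le> 1"
  obtain A B where AB: "\<And>t. poly_eval l (x + t *\<^sub>R (y - x)) = A + t * B"
    using poly_eval_affine_on_line[OF assms] by metis
  have "0 \<le> (1 - u) * A + u * (A + B)"
    using AB[of 0] AB[of 1] xy u by simp
  also have "\<dots> = poly_eval l ((1 - u) *\<^sub>R x + u *\<^sub>R y)"
    using AB[of u] by (simp add: algebra_simps)
  finally show "0 \<le> poly_eval l ((1 - u) *\<^sub>R x + u *\<^sub>R y)" .
qed

lemma closed_poly_eval_nonneg: "closed {x. poly_eval l x \<ge> 0}"
proof -
  have "continuous_on UNIV (poly_eval l)"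
    using poly_eval_differentiable differentiable_imp_continuous_within
    by (metis continuous_at_imp_continuous_on)
  then show ?thesis
    by (intro closed_Collect_le) auto
qed

text \<open>Each affine element of \<open>QM p r d\<close> is nonnegative on a closed convex set
  containing \<open>basic_closed p r\<close>.\<close>

lemma closure_convex_hull_subset_lasserre:
  "closure (convex hull (basic_closed p r)) \<subseteq> lasserre p r d"
proof -
  have "closure (convex hull (basic_closed p r)) \<subseteq> {x. poly_eval l x \<ge> 0}"
    if "l \<in> QM p r d" "l \<in> polys_upto 1" for l
    using that poly_eval_QM_nonneg
    by (intro closure_minimal hull_minimal closed_poly_eval_nonneg convex_poly_eval_nonneg) auto
  then show ?thesis
    by (fastforce simp: lasserre_def)
qed

text \<open>The uniform lower bound on offsets is itself the distance by which the relaxation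
  extends: an affine \<open>l\<close> negative at \<open>a - \<epsilon> *\<^sub>R w\<close> would,
  after division by its slope along \<open>w\<close>, have an offset below
  \<open>\<epsilon>\<close>.\<close>

lemma lasserre_exceeds_along_ray:
  fixes p :: "nat \<Rightarrow> 'n::finite rpoly" and a w :: "real ^ 'n"
  assumes a: "a \<in> basic_closed p r"
    and J: "infinite {t. a + t *\<^sub>R w \<in> basic_closed p r}"
    and gradient: "\<And>i. i \<in> {1..r} \<Longrightarrow> poly_eval (p i) a = 0 \<Longrightarrow> orthogonal (poly_gradient (p i) a) w"
  shows "\<exists>\<epsilon>>0. a - \<epsilon> *\<^sub>R w \<in> lasserre p r d"
proof -
  \<comment> \<open>The constant 1 at index 0 treats the free summand \<open>\<sigma> 0\<close> like
    the others.\<close>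
  define q where "q i = (if i = 0 then 1 else line_poly a w (p i))" for i
  have at0: "poly (q i) 0 > 0 \<or> poly (q i) 0 = 0 \<and> poly (pderiv (q i)) 0 = 0" if "i \<in> {0..r}" for i
  proof (cases "i = 0")
    case False
    then have i: "i \<in> {1..r}"
      using that by simp
    then have "poly_eval (p i) a \<ge> 0"
      using a by (simp add: basic_closed_def)
    moreover have "w \<bullet> poly_gradient (p i) a = 0" if "poly_eval (p i) a = 0"
      using gradient[OF i that] by (simp add: orthogonal_def inner_commute)
    ultimately show ?thesis
      using False by (cases "poly_eval (p i) a = 0") (simp_all add: q_def poly_pderiv_line_poly)
  qed (simp add: q_def)
  have nonneg: "poly (q i) t \<ge> 0" if "i \<in> {0..r}" "t \<in> {t. a + t *\<^sub>R w \<in> basic_closed p r}" for i t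
    using that by (auto simp: q_def basic_closed_def)
  have "\<exists>\<epsilon>>0. \<forall>\<alpha> \<sigma>. (\<forall>i\<in>{0..r}. degree (\<sigma> i) \<le> 2 * d \<and> (\<forall>t. poly (\<sigma> i) t \<ge> 0)) \<longrightarrow>
      (\<forall>t. (\<Sum>i\<in>{0..r}. poly (\<sigma> i) t * poly (q i) t) = t + \<alpha>) \<longrightarrow> \<epsilon> \<le> \<alpha>"
    by (rule weighted_sum_offset_bounded_below[OF finite_atLeastAtMost J])
      (erule (1) nonneg, erule at0)
  then obtain \<epsilon> where \<epsilon>: "\<epsilon> > 0" and lower:
    "\<forall>\<alpha> \<sigma>. (\<forall>i\<in>{0..r}. degree (\<sigma> i) \<le> 2 * d \<and> (\<forall>t. poly (\<sigma> i) t \<ge> 0)) \<longrightarrow>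
      (\<forall>t. (\<Sum>i\<in>{0..r}. poly (\<sigma> i) t * poly (q i) t) = t + \<alpha>) \<longrightarrow> \<epsilon> \<le> \<alpha>"
    by (elim exE conjE)
  have "poly_eval l (a - \<epsilon> *\<^sub>R w) \<ge> 0" if l: "l \<in> QM p r d" "l \<in> polys_upto 1" for l
  proof (rule ccontr)
    assume neg: "\<not> ?thesis"
    obtain A B where AB: "\<And>t. poly_eval l (a + t *\<^sub>R w) = A + t * B"
      using poly_eval_affine_on_line[OF l(2)] by metis
    have "A \<ge> 0"
      using AB[of 0] poly_eval_QM_nonneg[OF l(1) a] by simp
    moreover have less: "A < \<epsilon> * B"
      using neg AB[of "- \<epsilon>"] by simp
    \<comment> \<open>The slope is positive because \<open>0 \<le> A < \<epsilon> * B\<close>, so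
      dividing by \<open>B\<close> keeps the multipliers nonnegative.\<close>
    ultimately have B: "B > 0"
      using \<epsilon> by (meson le_less_trans zero_less_mult_pos)
    obtain s where s: "l = s 0 + (\<Sum>i=1..r. s i * p i)" "\<forall>i\<le>r. s i \<in> sums_of_squares d"
      using l(1) by (auto simp: QM_def)
    define on_line where "on_line i g \<longleftrightarrow> degree g \<le> 2 * d \<and> (\<forall>t. 0 \<le> poly g t) \<and>
        (\<forall>t. poly g t = poly_eval (s i) (a + t *\<^sub>R w))" for i g
    have "\<exists>g. on_line i g" if "i \<in> {0..r}" for i
    proof -
      have "s i \<in> sums_of_squares d"
        using s(2) that by simp
      then show ?thesis
        unfolding on_line_def by (rule sums_of_squares_on_line) blast
    qed
    then obtain f where f: "\<forall>i\<in>{0..r}. on_line i (f i)"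
      using bchoice[of "{0..r}" on_line] by blast
    have "(\<Sum>i\<in>{0..r}. poly (f i) t * poly (q i) t) = A + t * B" for t
    proof -
      have "(\<Sum>i\<in>{0..r}. poly (f i) t * poly (q i) t) =
          poly (f 0) t * poly (q 0) t + (\<Sum>i=1..r. poly (f i) t * poly (q i) t)"
        by (simp add: sum.atLeast_Suc_atMost)
      also have "\<dots> = poly_eval l (a + t *\<^sub>R w)"
        by (simp add: s(1) poly_eval_add poly_eval_sum poly_eval_mult f[unfolded on_line_def] q_def)
      finally show ?thesis
        by (simp add: AB)
    qed
    then have "\<forall>t. (\<Sum>i\<in>{0..r}. poly (smult (1 / B) (f i)) t * poly (q i) t) = t + A / B"
      using B by (simp add: sum_divide_distrib[symmetric] add_divide_distrib)
    moreover have "degree (f i) \<le> 2 * d" "0 \<le> poly (f i) t" if "i \<in> {0..r}" for i t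
      using f that unfolding on_line_def by blast+
    then have "\<forall>i\<in>{0..r}. degree (smult (1 / B) (f i)) \<le> 2 * d \<and>
        (\<forall>t. poly (smult (1 / B) (f i)) t \<ge> 0)"
      using B by simp
    ultimately have "\<epsilon> \<le> A / B"
      using lower[THEN spec[of _ "A / B"], THEN spec[of _ "\<lambda>i. smult (1 / B) (f i)"]] by blast
    then show False
      using less B by (simp add: pos_le_divide_eq)
  qed
  then show ?thesis
    using \<epsilon> by (auto simp: lasserre_def)
qed

section \<open>Topology relative to a line\<close>

lemma open_line_preimage:
  fixes a v :: "'a::real_normed_vector"
  assumes L: "L = range (\<lambda>t. a + t *\<^sub>R v)" and U: "openin (top_of_set L) U"
  shows "open {t. a + t *\<^sub>R v \<in> U}"
proof -
  obtain V where V: "open V" "U = L \<inter> V"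
    using U by (auto simp: openin_open)
  then have "{t. a + t *\<^sub>R v \<in> U} = (\<lambda>t. a + t *\<^sub>R v) -` V"
    using L by auto
  then show ?thesis
    using V(1) by (simp add: open_vimage continuous_intros)
qed

lemma interior_of_line:
  fixes a v :: "'a::real_inner"
  assumes L: "L = range (\<lambda>t. a + t *\<^sub>R v)" and v: "v \<noteq> 0" and \<delta>: "\<delta> > 0"
    and sub: "\<And>t. \<bar>t\<bar> < \<delta> \<Longrightarrow> a + t *\<^sub>R v \<in> T"
  shows "a \<in> top_of_set L interior_of T"
proof -
  \<comment> \<open>The quotient recovers the parameter \<open>t\<close> from a point of the line
    and is continuous on the whole space, so \<open>V\<close> is an open slab.\<close>
  define V where "V = {x. \<bar>((x - a) \<bullet> v) / (v \<bullet> v)\<bar> < \<delta>}"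
  have "open V"
    unfolding V_def using v by (intro open_Collect_less continuous_intros) auto
  then have "openin (top_of_set L) (L \<inter> V)"
    by (rule openin_open_Int)
  moreover have "L \<inter> V \<subseteq> T"
    using sub v by (auto simp: V_def L simp del: abs_divide)
  moreover have "a \<in> L \<inter> V"
    using \<delta> by (auto simp: V_def L intro!: range_eqI[of _ _ 0])
  ultimately show ?thesis
    unfolding interior_of_def by blast
qed

text \<open>By convexity the parameters of points in \<open>T\<close> form an interval; containing
  \<open>- \<epsilon>\<close> and \<open>s\<close>, it is a neighbourhood of 0.\<close>

lemma interior_convex_line:
  fixes a w :: "'a::real_inner"
  assumes L: "L = range (\<lambda>t. a + t *\<^sub>R w)" and w: "w \<noteq> 0"
    and T: "convex T" and st: "0 < s" "a + s *\<^sub>R w \<in> T" "0 < \<epsilon>" "a - \<epsilon> *\<^sub>R w \<in> T"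
  shows "a \<in> top_of_set L interior_of T"
proof (rule interior_of_line[OF L w])
  show "min s \<epsilon> > 0"
    using st by simp
  fix t assume t: "\<bar>t\<bar> < min s \<epsilon>"
  have "convex ((\<lambda>t. t *\<^sub>R w) -` ((\<lambda>x. x - a) ` T))"
    using T by (intro convex_linear_vimage convex_translation_subtract) (auto intro: linearI scaleR_left_distrib)
  moreover have "(\<lambda>t. t *\<^sub>R w) -` ((\<lambda>x. x - a) ` T) = {t. a + t *\<^sub>R w \<in> T}"
    by (force simp: image_iff algebra_simps)
  ultimately have "is_interval {t. a + t *\<^sub>R w \<in> T}"
    by (simp add: is_interval_convex_1)
  then show "a + t *\<^sub>R w \<in> T"
    using st t mem_is_interval_1_I[of "{t. a + t *\<^sub>R w \<in> T}" "- \<epsilon>" s t] by auto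
qed

theorem proposition4p1:
  fixes p :: "nat \<Rightarrow> 'n::finite rpoly" and r d :: nat
    and S L :: "(real ^ 'n) set" and a b v :: "real ^ 'n"
  assumes S: "S = basic_closed p r"
    and v: "v \<noteq> 0"
    and L: "L = {b + t *\<^sub>R v | t. True}"
    and interior: "top_of_set L interior_of (S \<inter> L) \<noteq> {}"
    and a: "a \<in> S"
    and boundary: "a \<in> top_of_set L frontier_of (closure (convex hull S) \<inter> L)"
    and gradient: "\<And>i. i \<in> {1..r} \<Longrightarrow> poly_eval (p i) a = 0 \<Longrightarrow> orthogonal (poly_gradient (p i) a) v"
  shows "closure (convex hull S) \<subset> lasserre p r d"
proof -
  let ?C = "closure (convex hull S)"
  have aL: "a \<in> L"
    using boundary frontier_of_subset_topspace by fastforce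
  have notint: "a \<notin> top_of_set L interior_of (?C \<inter> L)"
    using boundary by (simp add: frontier_of_def)
  obtain t0 where t0: "a = b + t0 *\<^sub>R v"
    using aL L by auto
  \<comment> \<open>The free scale \<open>c\<close> allows the direction of \<open>L\<close> to be
    reversed later.\<close>
  have La: "L = range (\<lambda>t. a + t *\<^sub>R (c *\<^sub>R v))" if "c \<noteq> 0" for c
  proof -
    have "b + t *\<^sub>R v = a + ((t - t0) / c) *\<^sub>R (c *\<^sub>R v)" for t
      using that by (simp add: t0 scaleR_left_diff_distrib)
    moreover have "a + t *\<^sub>R (c *\<^sub>R v) = b + (t0 + t * c) *\<^sub>R v" for t
      by (simp add: t0 algebra_simps)
    ultimately show ?thesis
      unfolding L by fast
  qed
  then have Lv: "L = range (\<lambda>t. a + t *\<^sub>R v)"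
    using La[of 1] by simp
  have SC: "S \<subseteq> ?C"
    using hull_subset closure_subset by fast
  define O1 where "O1 = {t. a + t *\<^sub>R v \<in> top_of_set L interior_of (S \<inter> L)}"
  have "open O1"
    unfolding O1_def by (rule open_line_preimage[OF Lv]) simp
  have OS: "a + t *\<^sub>R v \<in> S" if "t \<in> O1" for t
    using that interior_of_subset by (fastforce simp: O1_def)
  have "O1 \<noteq> {}"
    using interior interior_of_subset_topspace[of "top_of_set L" "S \<inter> L"] Lv
    by (fastforce simp: O1_def)
  \<comment> \<open>A nonempty open set of reals is infinite; this yields both the interpolation
    nodes and a point of \<open>S\<close> on \<open>L\<close> other than \<open>a\<close>.\<close>
  with \<open>open O1\<close> have inf: "infinite O1"
    using finite_imp_not_open by blast
  then obtain s where s: "s \<in> O1" "s \<noteq> 0"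
    by (metis finite.emptyI finite.insertI infinite_super insertI1 subsetI empty_iff singleton_iff)
  \<comment> \<open>The orientation puts the point of \<open>S\<close> with parameter
    \<open>s\<close> at \<open>a + \<bar>s\<bar> *\<^sub>R w\<close>, so the relaxation is extended
    on the opposite side of \<open>a\<close>.\<close>
  define w where "w = sgn s *\<^sub>R v"
  have sgn: "sgn s \<noteq> 0" "sgn s * sgn s = 1"
    using s(2) by (auto simp: sgn_if)
  have w: "w \<noteq> 0" "L = range (\<lambda>t. a + t *\<^sub>R w)"
    using v La[OF sgn(1)] sgn(1) by (auto simp: w_def)
  have "(\<lambda>t. sgn s * t) ` O1 \<subseteq> {t. a + t *\<^sub>R w \<in> basic_closed p r}"
    using OS sgn by (auto simp: w_def S mult.commute mult.left_commute)
  moreover have "infinite ((\<lambda>t. sgn s * t) ` O1)"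
    using inf sgn(1) by (subst finite_image_iff) (auto intro: inj_onI)
  ultimately have "infinite {t. a + t *\<^sub>R w \<in> basic_closed p r}"
    by (rule infinite_super)
  moreover have "orthogonal (poly_gradient (p i) a) w" if "i \<in> {1..r}" "poly_eval (p i) a = 0" for i
    using gradient[OF that] by (simp add: w_def orthogonal_clauses)
  ultimately obtain \<epsilon> where \<epsilon>: "\<epsilon> > 0" "a - \<epsilon> *\<^sub>R w \<in> lasserre p r d"
    using lasserre_exceeds_along_ray a S by metis
  \<comment> \<open>Otherwise \<open>a\<close> would lie strictly between two points of the closed
    hull on \<open>L\<close>, hence in its relative interior, contradicting the boundary
    assumption.\<close>
  moreover have "a - \<epsilon> *\<^sub>R w \<notin> ?C"
  proof
    assume in_hull: "a - \<epsilon> *\<^sub>R w \<in> ?C"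
    have "a + \<bar>s\<bar> *\<^sub>R w \<in> ?C"
      using OS[OF s(1)] SC by (auto simp: w_def abs_mult_sgn)
    then have "a \<in> top_of_set L interior_of ?C"
      using s(2) \<epsilon>(1) in_hull
      by (intro interior_convex_line[OF w(2,1), of _ "\<bar>s\<bar>" \<epsilon>] convex_closure convex_convex_hull) auto
    then show False
      using notint interior_of_restrict[of "top_of_set L" ?C] by (simp add: Int_commute)
  qed
  ultimately show ?thesis
    using closure_convex_hull_subset_lasserre S by blast
qed

end
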